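(* Let $X$ and $Y$ be geodesic metric spaces and let $\phi:X\to Y$ be a map such that $\phi(O^X_1(x))=O^Y_1(\phi(x))$ for all $x\in X$. Then $\phi(O^X_n(x))=O^Y_n(\phi(x))$ for every $n\in\mathbb{N}$ and every $x\in X$.
   Context: $\mathbb{N}=\{0,1,2,\dots\}$. For a metric space $(X,d)$, $O^X_n(x)=\{z\in X: d(x,z)\le n\}$ is the closed ball of radius $n$ around $x$ in $X$ (similarly for $Y$), and $\phi(S)$ denotes the image of a subset $S\subseteq X$. Metric spaces here are discrete: the metric takes values in $\mathbb{N}$. Such a metric space $(X,d)$ is called geodesic if for all $x,y\in X$ with $d(x,y)=k\geq 1$ there exist points $x=x_0,x_1,\dots,x_k=y$ in $X$ with $d(x_{i-1},x_i)=1$ for $i=1,\dots,k$. *)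

theory Defs
  imports "HOL-Analysis.Analysis"
begin

(* The library's carrier-based metric spaces are real-valued; a discrete metric
   space is one whose distances between points of the carrier lie in the image
   of the natural numbers. *)
locale nat_metric_space = Metric_space +
  assumes dist_in_Nats: "\<And>x y. \<lbrakk>x \<in> M; y \<in> M\<rbrakk> \<Longrightarrow> d x y \<in> \<nat>"

locale geodesic_nat_metric_space = nat_metric_space +
  assumes geodesic:
    "\<And>x y k. \<lbrakk>x \<in> M; y \<in> M; d x y = real k; k \<ge> 1\<rbrakk> \<Longrightarrow>
       \<exists>p :: nat \<Rightarrow> 'a. (\<forall>i\<le>k. p i \<in> M) \<and> p 0 = x \<and> p k = y \<and>
         (\<forall>i\<in>{1..k}. d (p (i - 1)) (p i) = 1)"

end

theory Submission
  imports Defs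
begin

text \<open>In a geodesic space the ball of radius \<open>n + 1\<close> is the union of the unit balls around the
  points of the ball of radius \<open>n\<close>. Images commute with unions, so the hypothesis on unit balls
  propagates to all radii by induction.\<close>

lemma (in geodesic_nat_metric_space) mcball_Suc:
  assumes "x \<in> M"
  shows "mcball x (real (Suc n)) = (\<Union>z\<in>mcball x (real n). mcball z 1)"
proof (intro equalityI subsetI)
  fix y assume y: "y \<in> mcball x (real (Suc n))"
  then have "y \<in> M" by simp
  \<comment> \<open>Integrality of the distance makes two cases exhaustive:
    \<open>k \<le> n\<close>, or exactly \<open>k = Suc n\<close>.\<close>
  obtain k where k: "d x y = real k"
    using dist_in_Nats[OF \<open>x \<in> M\<close> \<open>y \<in> M\<close>] by (auto elim: Nats_cases)
  show "y \<in> (\<Union>z\<in>mcball x (real n). mcball z 1)"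
  proof (cases "k \<le> n")
    case True
    \<comment> \<open>Here \<open>y\<close> can serve as its own centre.\<close>
    then have "y \<in> mcball x (real n)" "y \<in> mcball y 1"
      using \<open>x \<in> M\<close> \<open>y \<in> M\<close> k by simp_all
    then show ?thesis by blast
  next
    case False
    with y k have "k = Suc n" by simp
    \<comment> \<open>The centre will be \<open>p n\<close>, the last point before \<open>y\<close>
      on a geodesic from \<open>x\<close>. Shifting the index in \<open>step\<close> avoids the
      truncated subtraction \<open>i - 1\<close>.\<close>
    with geodesic[OF \<open>x \<in> M\<close> \<open>y \<in> M\<close> k]
    obtain p where p: "\<And>i. i \<le> Suc n \<Longrightarrow> p i \<in> M" "p 0 = x" "p (Suc n) = y"
      and step: "\<And>i. i \<le> n \<Longrightarrow> d (p i) (p (Suc i)) = 1"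
      by force
    \<comment> \<open>Add up the unit steps by the triangle inequality.\<close>
    have "d x (p i) \<le> real i" if "i \<le> n" for i
      using that
    proof (induction i)
      case 0
      then show ?case using p(2) \<open>x \<in> M\<close> by simp
    next
      case (Suc i)
      then show ?case
        using triangle[of x "p i" "p (Suc i)"] p(1)[of i] p(1)[of "Suc i"] step[of i] \<open>x \<in> M\<close>
        by simp
    qed
    then have "p n \<in> mcball x (real n)"
      using p(1)[of n] \<open>x \<in> M\<close> by simp
    moreover have "y \<in> mcball (p n) 1"
      using p step[of n] \<open>y \<in> M\<close> by auto
    ultimately show ?thesis by blast
  qed
next
  \<comment> \<open>This inclusion is the triangle inequality and holds in every metric
    space.\<close>
  fix y assume "y \<in> (\<Union>z\<in>mcball x (real n). mcball z 1)"
  then obtain z where "z \<in> M" "y \<in> M" "d x z \<le> real n" "d z y \<le> 1"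
    by auto
  then show "y \<in> mcball x (real (Suc n))"
    using triangle[of x z y] \<open>x \<in> M\<close> by simp
qed

theorem proposition1:
  fixes X :: "'a set" and dX :: "'a \<Rightarrow> 'a \<Rightarrow> real"
    and Y :: "'b set" and dY :: "'b \<Rightarrow> 'b \<Rightarrow> real"
    and \<phi> :: "'a \<Rightarrow> 'b"
  assumes "geodesic_nat_metric_space X dX"
    and "geodesic_nat_metric_space Y dY"
    and "\<phi> \<in> X \<rightarrow> Y"
    and "\<forall>x\<in>X. \<phi> ` Metric_space.mcball X dX x 1 = Metric_space.mcball Y dY (\<phi> x) 1"
  shows "\<forall>n::nat. \<forall>x\<in>X.
    \<phi> ` Metric_space.mcball X dX x (real n) = Metric_space.mcball Y dY (\<phi> x) (real n)"
proof (intro allI ballI)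
  interpret X: geodesic_nat_metric_space X dX by fact
  interpret Y: geodesic_nat_metric_space Y dY by fact
  fix n :: nat and x assume "x \<in> X"
  then have "\<phi> x \<in> Y" using assms(3) by auto
  show "\<phi> ` X.mcball x (real n) = Y.mcball (\<phi> x) (real n)"
  \<comment> \<open>The centre \<open>x\<close> stays fixed: the induction hypothesis is used at
    \<open>x\<close> alone, while the unit-ball assumption is applied at every point of the
    \<open>n\<close>-ball.\<close>
  proof (induction n)
    case 0
    \<comment> \<open>A nonnegative distance that is at most 0 vanishes, so the points
      coincide.\<close>
    have "X.mcball x 0 = {x}" "Y.mcball (\<phi> x) 0 = {\<phi> x}"
      using \<open>x \<in> X\<close> \<open>\<phi> x \<in> Y\<close>
      by (auto simp: X.mcball_def Y.mcball_def order_antisym_conv[OF X.nonneg] order_antisym_conv[OF Y.nonneg])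
    then show ?case by simp
  next
    case (Suc n)
    \<comment> \<open>Geodesicity of \<open>X\<close> enters here, that of \<open>Y\<close> in the
      last equality of the chain.\<close>
    have "\<phi> ` X.mcball x (real (Suc n)) = (\<Union>z\<in>X.mcball x (real n). \<phi> ` X.mcball z 1)"
      by (simp only: X.mcball_Suc[OF \<open>x \<in> X\<close>] image_UN)
    also have "\<dots> = (\<Union>z\<in>X.mcball x (real n). Y.mcball (\<phi> z) 1)"
      using assms(4) by (intro SUP_cong) auto
    \<comment> \<open>The summand depends on \<open>z\<close> only through \<open>\<phi> z\<close>,
      so the union can run over the image, which the induction hypothesis identifies.\<close>
    also have "\<dots> = (\<Union>w\<in>\<phi> ` X.mcball x (real n). Y.mcball w 1)"
      by blast
    also have "\<dots> = Y.mcball (\<phi> x) (real (Suc n))"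
      by (simp only: Suc.IH Y.mcball_Suc[OF \<open>\<phi> x \<in> Y\<close>])
    finally show ?case .
  qed
qed

end
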